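(* Let $(L,\le)$ be a quasi lattice and let $\Lambda,\Pi\subseteq\mathrm{Endo}_{\mathbf{QL}}(L,\le)$. If $\le$ is $(\Lambda,\Pi)$-strict, then $\le$ is $(\Lambda,\Pi)$-correct.
   Context: A quasi order is a set with a reflexive transitive relation. A quasi lattice is a quasi order $(L,\le)$ such that for all $p,q\in L$ the set $\{p,q\}$ has both an infimum (a greatest lower bound) and a supremum (a least upper bound), not necessarily unique; $p\land q$ and $p\lor q$ denote the sets of all infimums and of all supremums of $\{p,q\}$, respectively. $\mathrm{Endo}_{\mathbf{QL}}(L,\le)$ is the set of all $f:L\to L$ such that for all $p,q,r,s\in L$: $r\in p\land q$ implies $f(r)\in f(p)\land f(q)$, and $s\in p\lor q$ implies $f(s)\in f(p)\lor f(q)$. $p<q$ means $p\le q$ and $q\nleq p$. $\le$ is $(\Lambda,\Pi)$-strict if for all $p,q\in L$ with $p<q$ there is $\sigma\in\Lambda$ such that $\tau(\sigma(p))<\tau(\sigma(q))$ for all $\tau\in\Pi$. $\le$ is $(\Lambda,\Pi)$-correct if for all $p,q\in L$ with $p\nleq q$ there is $\sigma\in\Lambda$ such that $\tau(\sigma(p))\nleq\tau(\sigma(q))$ for all $\tau\in\Pi$. *)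

theory Defs
  imports Main "HOL-Library.FuncSet"
begin

text \<open>
  A quasi order is given by a carrier set \<open>L\<close> and a relation \<open>le\<close> of which only the
  restriction to \<open>L\<close> matters; every bound variable below is relativised to \<open>L\<close>.
\<close>

definition quasi_order :: "'a set \<Rightarrow> ('a \<Rightarrow> 'a \<Rightarrow> bool) \<Rightarrow> bool" where
  "quasi_order L le \<longleftrightarrow> reflp_on L le \<and> transp_on L le"

definition infimums :: "'a set \<Rightarrow> ('a \<Rightarrow> 'a \<Rightarrow> bool) \<Rightarrow> 'a set \<Rightarrow> 'a set" where
  "infimums L le S =
     {r \<in> L. (\<forall>x\<in>S. le r x) \<and> (\<forall>l\<in>L. (\<forall>x\<in>S. le l x) \<longrightarrow> le l r)}"

definition supremums :: "'a set \<Rightarrow> ('a \<Rightarrow> 'a \<Rightarrow> bool) \<Rightarrow> 'a set \<Rightarrow> 'a set" where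
  "supremums L le S =
     {s \<in> L. (\<forall>x\<in>S. le x s) \<and> (\<forall>u\<in>L. (\<forall>x\<in>S. le x u) \<longrightarrow> le s u)}"

definition quasi_lattice :: "'a set \<Rightarrow> ('a \<Rightarrow> 'a \<Rightarrow> bool) \<Rightarrow> bool" where
  "quasi_lattice L le \<longleftrightarrow>
     quasi_order L le \<and>
     (\<forall>p\<in>L. \<forall>q\<in>L. infimums L le {p, q} \<noteq> {} \<and> supremums L le {p, q} \<noteq> {})"

text \<open>
  As for the homomorphism sets of \<open>HOL-Algebra\<close>, a map \<open>L \<rightarrow> L\<close> is a function on the
  ambient type mapping \<open>L\<close> into \<open>L\<close>; its values outside \<open>L\<close> are irrelevant.
\<close>

definition Endo_QL :: "'a set \<Rightarrow> ('a \<Rightarrow> 'a \<Rightarrow> bool) \<Rightarrow> ('a \<Rightarrow> 'a) set" where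
  "Endo_QL L le =
     {f \<in> L \<rightarrow> L. \<forall>p\<in>L. \<forall>q\<in>L. \<forall>r\<in>L. \<forall>s\<in>L.
        (r \<in> infimums L le {p, q} \<longrightarrow> f r \<in> infimums L le {f p, f q}) \<and>
        (s \<in> supremums L le {p, q} \<longrightarrow> f s \<in> supremums L le {f p, f q})}"

definition strictly_below :: "('a \<Rightarrow> 'a \<Rightarrow> bool) \<Rightarrow> 'a \<Rightarrow> 'a \<Rightarrow> bool" where
  "strictly_below le p q \<longleftrightarrow> le p q \<and> \<not> le q p"

definition strict_wrt ::
    "'a set \<Rightarrow> ('a \<Rightarrow> 'a \<Rightarrow> bool) \<Rightarrow> ('a \<Rightarrow> 'a) set \<Rightarrow> ('a \<Rightarrow> 'a) set \<Rightarrow> bool" where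
  "strict_wrt L le \<Lambda> P \<longleftrightarrow>
     (\<forall>p\<in>L. \<forall>q\<in>L. strictly_below le p q \<longrightarrow>
        (\<exists>\<sigma>\<in>\<Lambda>. \<forall>\<tau>\<in>P. strictly_below le (\<tau> (\<sigma> p)) (\<tau> (\<sigma> q))))"

definition correct_wrt ::
    "'a set \<Rightarrow> ('a \<Rightarrow> 'a \<Rightarrow> bool) \<Rightarrow> ('a \<Rightarrow> 'a) set \<Rightarrow> ('a \<Rightarrow> 'a) set \<Rightarrow> bool" where
  "correct_wrt L le \<Lambda> P \<longleftrightarrow>
     (\<forall>p\<in>L. \<forall>q\<in>L. \<not> le p q \<longrightarrow>
        (\<exists>\<sigma>\<in>\<Lambda>. \<forall>\<tau>\<in>P. \<not> le (\<tau> (\<sigma> p)) (\<tau> (\<sigma> q))))"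

end

theory Submission
  imports Defs
begin

text \<open>
  If \<open>p \<le> q\<close> fails, then an infimum \<open>r\<close> of \<open>p\<close> and \<open>q\<close> lies strictly below \<open>p\<close>.
  The map \<open>\<sigma>\<close> that strictness provides for \<open>r < p\<close> works for \<open>p\<close> and \<open>q\<close>, because
  \<open>\<tau> (\<sigma> r)\<close> is an infimum of \<open>\<tau> (\<sigma> p)\<close> and \<open>\<tau> (\<sigma> q)\<close>, and an infimum of two elements
  is strictly below the first only if the first is not below the second.
\<close>

lemma Endo_QL_mem:
  assumes "f \<in> Endo_QL L le" "p \<in> L"
  shows "f p \<in> L"
  using assms by (auto simp: Endo_QL_def)

lemma Endo_QL_infimums:
  assumes "f \<in> Endo_QL L le" "p \<in> L" "q \<in> L" "r \<in> infimums L le {p, q}"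
  shows "f r \<in> infimums L le {f p, f q}"
proof -
  have "r \<in> L"
    using assms(4) by (simp add: infimums_def)
  with assms show ?thesis
    unfolding Endo_QL_def by blast
qed

text \<open>Since \<open>le r p\<close> always holds, strictness only says that
  \<open>le p r\<close> fails, and \<open>le p r\<close> is equivalent to
  \<open>le p q\<close>.\<close>

lemma strictly_below_infimum_iff:
  assumes "quasi_order L le" "p \<in> L" "q \<in> L" "r \<in> infimums L le {p, q}"
  shows "strictly_below le r p \<longleftrightarrow> \<not> le p q"
proof -
  have r: "r \<in> L" "le r p" "le r q" "\<And>l. l \<in> L \<Longrightarrow> le l p \<Longrightarrow> le l q \<Longrightarrow> le l r"
    using assms(4) by (auto simp: infimums_def)
  \<comment> \<open>By reflexivity, \<open>le p q\<close> makes \<open>p\<close> itself a lower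
    bound of both elements, hence below \<open>r\<close>.\<close>
  have "le p p"
    using assms(1,2) by (auto simp: quasi_order_def dest: reflp_onD)
  moreover have "le p q" if "le p r"
    using assms(1-3) r that by (auto simp: quasi_order_def dest: transp_onD)
  ultimately show ?thesis
    using assms(2) r by (auto simp: strictly_below_def)
qed

theorem lemma4p11:
  fixes L :: "'a set" and le :: "'a \<Rightarrow> 'a \<Rightarrow> bool"
    and \<Lambda> P :: "('a \<Rightarrow> 'a) set"
  assumes "quasi_lattice L le"
    and "\<Lambda> \<subseteq> Endo_QL L le" and "P \<subseteq> Endo_QL L le"
    and "strict_wrt L le \<Lambda> P"
  shows "correct_wrt L le \<Lambda> P"
  unfolding correct_wrt_def
proof (intro ballI impI)
  fix p q assume pq: "p \<in> L" "q \<in> L" and "\<not> le p q"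
  have qo: "quasi_order L le"
    using assms(1) by (simp add: quasi_lattice_def)
  obtain r where r: "r \<in> infimums L le {p, q}"
    using assms(1) pq unfolding quasi_lattice_def by blast
  have "r \<in> L"
    using r by (simp add: infimums_def)
  moreover have "strictly_below le r p"
    using strictly_below_infimum_iff[OF qo pq r] \<open>\<not> le p q\<close> by simp
  ultimately obtain \<sigma> where \<sigma>: "\<sigma> \<in> \<Lambda>" "\<forall>\<tau>\<in>P. strictly_below le (\<tau> (\<sigma> r)) (\<tau> (\<sigma> p))"
    using assms(4) pq unfolding strict_wrt_def by blast
  have "\<not> le (\<tau> (\<sigma> p)) (\<tau> (\<sigma> q))" if "\<tau> \<in> P" for \<tau>
  proof -
    have endo: "\<sigma> \<in> Endo_QL L le" "\<tau> \<in> Endo_QL L le"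
      using assms(2,3) \<sigma>(1) that by auto
    have \<sigma>_mem: "\<sigma> p \<in> L" "\<sigma> q \<in> L"
      using Endo_QL_mem[OF endo(1)] pq by auto
    have \<tau>_mem: "\<tau> (\<sigma> p) \<in> L" "\<tau> (\<sigma> q) \<in> L"
      using Endo_QL_mem[OF endo(2)] \<sigma>_mem by auto
    have "\<tau> (\<sigma> r) \<in> infimums L le {\<tau> (\<sigma> p), \<tau> (\<sigma> q)}"
      by (rule Endo_QL_infimums[OF endo(2) \<sigma>_mem Endo_QL_infimums[OF endo(1) pq r]])
    \<comment> \<open>The equivalence that gave \<open>r\<close> strictly below \<open>p\<close> is
      now read in the other direction, at the images under \<sigma> followed by \<tau>.\<close>
    then show ?thesis
      using strictly_below_infimum_iff[OF qo \<tau>_mem] \<sigma>(2) that by blast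
  qed
  with \<sigma>(1) show "\<exists>\<sigma>\<in>\<Lambda>. \<forall>\<tau>\<in>P. \<not> le (\<tau> (\<sigma> p)) (\<tau> (\<sigma> q))"
    by blast
qed

end
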